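(* Let $d>1$ be an integer, let $S_0>0$, $a\in\mathbb{R}$, $b>0$, let $\mathcal{S}:\mathbb{R}^d\to\mathbb{R}^d$ be the Gaussian price map defined in the context, and let $g:\mathbb{R}^d\to\mathbb{R}$. Assume that there are an integer $r$ with $1\le r<d$, a matrix $\bm W=[\bm w_1,\dots,\bm w_r]\in\mathbb{R}^{d\times r}$ with $\mathrm{rank}(\bm W)=r$, and a function $G:\mathbb{R}^r\to\mathbb{R}$ such that $$g(\mathcal{S}(\bm z))=G(\bm W^\top\bm z)=G(\bm w_1^\top\bm z,\dots,\bm w_r^\top\bm z)\quad\text{for all }\bm z\in\mathbb{R}^d.$$ Let $\bm W_{-1}\in\mathbb{R}^{(d-1)\times r}$ be the matrix formed by the last $d-1$ rows of $\bm W$ (i.e. $\bm W$ with its first row removed), and let $\bm W_{-1}=\bm Q\bm R$ be a QR decomposition, where $\bm Q\in\mathbb{R}^{(d-1)\times(d-1)}$ is orthogonal and $\bm R\in\mathbb{R}^{(d-1)\times r}$ is upper triangular. Let $\bm U$ be the $d\times d$ orthogonal matrix $$\bm U=\begin{bmatrix}1&\bm 0^\top\\ \bm 0&\bm V\end{bmatrix}\quad\text{with }\bm V=\bm Q.$$ Then there are constants $\alpha_i$ ($1\le i\le r$) and $\ell_{ij}$ ($1\le j\le i\le r$) such that for all $\bm z=(z_1,\dots,z_d)^\top\in\mathbb{R}^d$, $$g(\mathcal{S}(\bm U\bm z))=G\bigl(\alpha_1z_1+\ell_{11}z_2,\ \alpha_2z_1+\ell_{21}z_2+\ell_{22}z_3,\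 \dots,\ \alpha_rz_1+\ell_{r1}z_2+\dots+\ell_{rr}z_{r+1}\bigr).$$
   Context: The Gaussian price map $\mathcal{S}=(\mathcal{S}_1,\dots,\mathcal{S}_d)^\top:\mathbb{R}^d\to\mathbb{R}^d$ with parameters $S_0>0$ (initial price), $a\in\mathbb{R}$, $b>0$ is $$\mathcal{S}_i(\bm z)=S_0\exp(x_1+\dots+x_i),\qquad \bm x=a\bm 1+b\bm z,\qquad i=1,\dots,d,$$ where $\bm 1=(1,\dots,1)^\top$ (so the number of time steps equals $d$, and $\bm z$ is a realization of a standard normal vector $N(\bm 0,\bm I_d)$). A (possibly non-square) matrix $\bm R=(R_{ij})$ is called upper triangular if $R_{ij}=0$ whenever $i>j$. *)

theory Defs
  imports Complex_Main "Jordan_Normal_Form.DL_Rank"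
begin

text \<open>
  Vectors in \<open>\<real>\<^sup>n\<close> are elements of \<open>carrier_vec n\<close>, and real \<open>m \<times> n\<close> matrices are elements of
  \<open>carrier_mat m n\<close>. All indices start at 0, so \<open>z $ i\<close> is the coordinate usually written
  \<open>z\<^sub>i\<^sub>+\<^sub>1\<close>. Functions on \<open>\<real>\<^sup>n\<close> are HOL functions on \<^typ>\<open>real vec\<close>
  whose values outside \<open>carrier_vec n\<close> are irrelevant.
\<close>

definition gaussian_price_map :: "real \<Rightarrow> real \<Rightarrow> real \<Rightarrow> nat \<Rightarrow> real vec \<Rightarrow> real vec" where
  "gaussian_price_map S0 a b d z =
    (let x = a \<cdot>\<^sub>v vec d (\<lambda>_. 1) + b \<cdot>\<^sub>v z
     in vec d (\<lambda>i. S0 * exp (\<Sum>k\<le>i. x $ k)))"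

text \<open>
  The library predicate \<^const>\<open>upper_triangular\<close> is meant for square matrices: on a matrix with
  more rows than columns it also refers to entries outside the matrix. The predicate
  \<^const>\<open>orthogonal_mat\<close> only asks for nonzero, pairwise orthogonal columns, without normalization.
  Neither is what a QR decomposition of a rectangular matrix needs.
\<close>

definition rect_upper_triangular :: "real mat \<Rightarrow> bool" where
  "rect_upper_triangular R \<longleftrightarrow>
    (\<forall>i < dim_row R. \<forall>j < dim_col R. j < i \<longrightarrow> R $$ (i, j) = 0)"

definition real_orthogonal_mat :: "nat \<Rightarrow> real mat \<Rightarrow> bool" where
  "real_orthogonal_mat n Q \<longleftrightarrow>
    Q \<in> carrier_mat n n \<and> transpose_mat Q * Q = 1\<^sub>m n \<and> Q * transpose_mat Q = 1\<^sub>m n"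

definition qr_decomposition :: "real mat \<Rightarrow> real mat \<Rightarrow> real mat \<Rightarrow> bool" where
  "qr_decomposition A Q R \<longleftrightarrow>
    real_orthogonal_mat (dim_row A) Q \<and>
    R \<in> carrier_mat (dim_row A) (dim_col A) \<and> rect_upper_triangular R \<and>
    A = Q * R"

definition remove_first_row :: "real mat \<Rightarrow> real mat" where
  "remove_first_row A = mat (dim_row A - 1) (dim_col A) (\<lambda>(i, j). A $$ (Suc i, j))"

definition border_one :: "real mat \<Rightarrow> real mat" where
  "border_one V =
    four_block_mat (1\<^sub>m 1) (0\<^sub>m 1 (dim_col V)) (0\<^sub>m (dim_row V) 1) V"

lemma real_orthogonal_border_one:
  assumes "real_orthogonal_mat n V"
  shows "real_orthogonal_mat (Suc n) (border_one V)"
proof -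
  have V: "V \<in> carrier_mat n n" "transpose_mat V * V = 1\<^sub>m n" "V * transpose_mat V = 1\<^sub>m n"
    using assms by (auto simp: real_orthogonal_mat_def)
  have T: "transpose_mat (border_one V) =
      four_block_mat (1\<^sub>m 1) (0\<^sub>m 1 n) (0\<^sub>m n 1) (transpose_mat V)"
    using V(1) by (auto simp: border_one_def transpose_four_block_mat[of _ 1 1 _ n _ n])
  have B: "border_one V = four_block_mat (1\<^sub>m 1) (0\<^sub>m 1 n) (0\<^sub>m n 1) V"
    using V(1) by (simp add: border_one_def)
  have one: "four_block_mat (1\<^sub>m 1) (0\<^sub>m 1 n) (0\<^sub>m n 1) (1\<^sub>m n) = (1\<^sub>m (Suc n) :: real mat)"
    by (rule eq_matI) auto
  show ?thesis
    unfolding real_orthogonal_mat_def T unfolding B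
    using V one
    by (auto simp: mult_four_block_mat[of _ 1 1 _ n _ n _ _ 1 _ n])
qed

end

theory Submission
  imports Defs
begin

text \<open>
  Since \<open>U\<^sup>T W\<close> is the first row of \<open>W\<close> stacked on \<open>Q\<^sup>T W\<^sub>-\<^sub>1 = R\<close>, we have
  \<open>W\<^sup>T U z = (U\<^sup>T W)\<^sup>T z\<close>, and the triangular shape of \<open>R\<close> cuts the \<open>i\<close>-th coordinate off
  after \<open>z $ Suc i\<close>. So \<open>\<alpha> i = W $$ (0, i)\<close> and \<open>l i j = R $$ (j, i)\<close>.
\<close>

definition prepend_row :: "(nat \<Rightarrow> 'a) \<Rightarrow> 'a mat \<Rightarrow> 'a mat" where
  "prepend_row w A = mat (Suc (dim_row A)) (dim_col A)
    (\<lambda>(i, j). case i of 0 \<Rightarrow> w j | Suc k \<Rightarrow> A $$ (k, j))"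

lemma prepend_row_carrier [simp, intro]:
  "A \<in> carrier_mat m n \<Longrightarrow> prepend_row w A \<in> carrier_mat (Suc m) n"
  by (simp add: prepend_row_def)

lemma prepend_row_remove_first_row:
  assumes "A \<in> carrier_mat (Suc m) n"
  shows "prepend_row (\<lambda>j. A $$ (0, j)) (remove_first_row A) = A"
  using assms by (auto simp: prepend_row_def remove_first_row_def split: nat.split)

text \<open>Block multiplication: the bordering \<open>1\<close> carries the top row
  \<open>w\<close> through unchanged, and the zero blocks let \<open>V\<close> act on
  \<open>A\<close> alone. This turns a QR factorization of the lower rows into a factorization of
  the whole matrix.\<close>

lemma border_one_mult_prepend_row:
  assumes "V \<in> carrier_mat m n" and "A \<in> carrier_mat n k"
  shows "border_one V * prepend_row w A = prepend_row w (V * A)"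
proof (rule eq_matI)
  fix i j
  assume "i < dim_row (prepend_row w (V * A))" "j < dim_col (prepend_row w (V * A))"
  then have ij: "i < Suc m" "j < k"
    using assms by (auto simp: prepend_row_def)
  have "(border_one V * prepend_row w A) $$ (i, j) =
      (\<Sum>q<Suc n. border_one V $$ (i, q) * prepend_row w A $$ (q, j))"
    using assms ij
    by (auto simp: border_one_def prepend_row_def scalar_prod_def lessThan_atLeast0)
  also have "\<dots> = border_one V $$ (i, 0) * w j + (\<Sum>q<n. border_one V $$ (i, Suc q) * A $$ (q, j))"
    using assms ij
    by (simp add: prepend_row_def sum.lessThan_Suc_shift del: sum.lessThan_Suc)
  \<comment> \<open>For \<open>i = 0\<close> only the leading term survives; for
    \<open>i = Suc k\<close> it vanishes and row \<open>k\<close> of \<open>V\<close>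
    remains.\<close>
  also have "\<dots> = prepend_row w (V * A) $$ (i, j)"
    using assms ij
    by (cases i) (auto simp: border_one_def prepend_row_def scalar_prod_def lessThan_atLeast0)
  finally show "(border_one V * prepend_row w A) $$ (i, j) = prepend_row w (V * A) $$ (i, j)" .
qed (use assms in \<open>auto simp: border_one_def prepend_row_def\<close>)

text \<open>Placing a row on top of \<open>R\<close> moves its zero pattern down by one, so column
  \<open>i\<close> of the stacked matrix vanishes below row \<open>Suc i\<close>.\<close>

lemma transpose_prepend_row_mult_vec:
  fixes R :: "real mat"
  assumes R: "R \<in> carrier_mat m n" "rect_upper_triangular R"
    and "n \<le> m" and z: "z \<in> carrier_vec (Suc m)"
  shows "transpose_mat (prepend_row w R) *\<^sub>v z =
    vec n (\<lambda>i. w i * z $ 0 + (\<Sum>j\<le>i. R $$ (j, i) * z $ Suc j))"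
proof (rule eq_vecI)
  fix i
  assume "i < dim_vec (vec n (\<lambda>i. w i * z $ 0 + (\<Sum>j\<le>i. R $$ (j, i) * z $ Suc j)))"
  then have i: "i < n" by simp
  have "(transpose_mat (prepend_row w R) *\<^sub>v z) $ i =
      (\<Sum>q<Suc m. prepend_row w R $$ (q, i) * z $ q)"
    using R z i by (auto simp: prepend_row_def scalar_prod_def lessThan_atLeast0)
  also have "\<dots> = w i * z $ 0 + (\<Sum>j<m. R $$ (j, i) * z $ Suc j)"
    using R i
    by (simp add: prepend_row_def sum.lessThan_Suc_shift del: sum.lessThan_Suc)
  \<comment> \<open>Terms with \<open>i < j\<close> vanish by triangularity; \<open>i < n\<close>
    and \<open>n \<le> m\<close> place all indices \<open>j \<le> i\<close> inside the range
    \<open>j < m\<close>.\<close>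
  also have "(\<Sum>j<m. R $$ (j, i) * z $ Suc j) = (\<Sum>j\<le>i. R $$ (j, i) * z $ Suc j)"
    using R i \<open>n \<le> m\<close>
    by (intro sum.mono_neutral_right) (auto simp: rect_upper_triangular_def)
  finally show "(transpose_mat (prepend_row w R) *\<^sub>v z) $ i =
      vec n (\<lambda>i. w i * z $ 0 + (\<Sum>j\<le>i. R $$ (j, i) * z $ Suc j)) $ i"
    using i by simp
qed (use R in \<open>auto simp: prepend_row_def\<close>)

theorem theorem2:
  fixes d r :: nat
    and S0 a b :: real
    and g G :: "real vec \<Rightarrow> real"
    and W Q R U :: "real mat"
  assumes "d > 1"
    and "S0 > 0"
    and "b > 0"
    and "1 \<le> r" and "r < d"
    and "W \<in> carrier_mat d r"
    and "vec_space.rank d W = r"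
    and "\<forall>z \<in> carrier_vec d. g (gaussian_price_map S0 a b d z) = G (transpose_mat W *\<^sub>v z)"
    and "qr_decomposition (remove_first_row W) Q R"
    and "U = border_one Q"
  shows "\<exists>(\<alpha> :: nat \<Rightarrow> real) (l :: nat \<Rightarrow> nat \<Rightarrow> real).
    \<forall>z \<in> carrier_vec d.
      g (gaussian_price_map S0 a b d (U *\<^sub>v z)) =
      G (vec r (\<lambda>i. \<alpha> i * z $ 0 + (\<Sum>j\<le>i. l i j * z $ Suc j)))"
proof -
  obtain m where d: "d = Suc m"
    using \<open>d > 1\<close> by (cases d) auto
  note W = \<open>W \<in> carrier_mat d r\<close>
  let ?w = "\<lambda>i. W $$ (0, i)"
  let ?B = "prepend_row ?w R"
  have qr: "real_orthogonal_mat m Q" "R \<in> carrier_mat m r" "rect_upper_triangular R"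
      "remove_first_row W = Q * R"
    using assms(9) W d by (auto simp: qr_decomposition_def remove_first_row_def)
  have Q: "Q \<in> carrier_mat m m"
    using qr(1) by (simp add: real_orthogonal_mat_def)
  have U: "U \<in> carrier_mat d d" "transpose_mat U * U = 1\<^sub>m d"
    using real_orthogonal_border_one[OF qr(1)] \<open>U = border_one Q\<close> d
    by (auto simp: real_orthogonal_mat_def)
  have B: "?B \<in> carrier_mat d r"
    using qr(2) d by simp
  \<comment> \<open>The matrix \<open>W\<close> is its first row on top of \<open>Q * R\<close>, and
    the factor \<open>Q\<close> is pulled out as \<open>U\<close>.\<close>
  have "W = U * ?B"
    using prepend_row_remove_first_row[of W m r] border_one_mult_prepend_row[OF Q qr(2)]
      W d qr(4) \<open>U = border_one Q\<close> by simp
  \<comment> \<open>Transposing \<open>W = U * ?B\<close> and multiplying by \<open>U\<close> on the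
    right lets orthogonality cancel \<open>U\<close>.\<close>
  then have WU: "transpose_mat W * U = transpose_mat ?B"
    using U B transpose_mult[of U d d ?B r]
      assoc_mult_mat[of "transpose_mat ?B" r d "transpose_mat U" d U d]
    by simp
  have "g (gaussian_price_map S0 a b d (U *\<^sub>v z)) =
      G (vec r (\<lambda>i. ?w i * z $ 0 + (\<Sum>j\<le>i. R $$ (j, i) * z $ Suc j)))"
    if z: "z \<in> carrier_vec d" for z
  proof -
    have "g (gaussian_price_map S0 a b d (U *\<^sub>v z)) = G (transpose_mat W *\<^sub>v (U *\<^sub>v z))"
      using assms(8) U(1) z by auto
    also have "transpose_mat W *\<^sub>v (U *\<^sub>v z) = transpose_mat ?B *\<^sub>v z"
      using assoc_mult_mat_vec[of "transpose_mat W" r d U d z] W U(1) z WU by simp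
    finally show ?thesis
      \<comment> \<open>The strict bound \<open>r < d\<close> with \<open>d = Suc m\<close> is
        exactly \<open>r \<le> m\<close>, so the last coordinate used, \<open>z $ r\<close>,
        exists.\<close>
      using transpose_prepend_row_mult_vec[OF qr(2,3)] z \<open>r < d\<close> d by simp
  qed
  then show ?thesis
    by (intro exI[of _ ?w] exI[of _ "\<lambda>i j. R $$ (j, i)"]) blast
qed

end
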